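(* Let $\mathcal{K}$ be a Krein space and $\mathcal{H}$ a Hilbert space with $\mathcal{K}\cap\mathcal{H}=\{0\}$, and let $\tilde{\mathcal{K}}=\mathcal{K}[+]\mathcal{H}$. Let $\tilde A\subseteq\tilde{\mathcal{K}}\times\tilde{\mathcal{K}}$ be a self-adjoint linear relation which is of the form $\tilde A=A_1[+]A_2$ with linear relations $A_1\subseteq\mathcal{K}\times\mathcal{K}$ and $A_2\subseteq\mathcal{H}\times\mathcal{H}$. Then the relation $\Gamma=\mathcal{J}^{-1}(\tilde A):\mathcal{K}^2\to\mathcal{H}^2$ is a trivial unitary Green's boundary relation. Conversely, let $\Gamma:\mathcal{K}^2\to\mathcal{H}^2$ be a trivial unitary Green's boundary relation. Then $\tilde A=\mathcal{J}(\Gamma)$ is a self-adjoint relation in $\tilde{\mathcal{K}}$ of the form $\tilde A=A_1[+]A_2$ with linear relations $A_1\subseteq\mathcal{K}\times\mathcal{K}$ and $A_2\subseteq\mathcal{H}\times\mathcal{H}$.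
   Context: $(\mathcal{K},[\cdot,\cdot])$ is a complex Krein space and $(\mathcal{H},(\cdot,\cdot))$ a Hilbert space. $\tilde{\mathcal{K}}=\mathcal{K}[+]\mathcal{H}$ is the direct orthogonal sum, i.e. the Krein space $\mathcal{K}\times\mathcal{H}$ with inner product $[(f,h),(g,k)]=[f,g]+(h,k)$. A linear relation $X\to Y$ is a linear subspace of $X\times Y$. For linear relations $A_1\subseteq\mathcal{K}\times\mathcal{K}$ and $A_2\subseteq\mathcal{H}\times\mathcal{H}$, $$A_1[+]A_2:=\left\{\left(\begin{pmatrix} f_1 \\ f_2 \end{pmatrix},\begin{pmatrix} f_1' \\ f_2' \end{pmatrix}\right):(f_i,f_i')\in A_i,\ i=1,2\right\}\subseteq\tilde{\mathcal{K}}\times\tilde{\mathcal{K}}.$$ A linear relation $A$ in a Krein space is self-adjoint if $A=A^+$, where $A^+=\{(k,h):[f,h]=[g,k]\ \forall(f,g)\in A\}$. The main transformation $\mathcal{J}$ maps a linear relation $\Gamma\subseteq\mathcal{K}^2\times\mathcal{H}^2$ to $$\mathcal{J}(\Gamma)=\left\{\left(\begin{pmatrix} f \\ h \end{pmatrix},\begin{pmatrix} f' \\ -h' \end{pmatrix}\right):\left(\begin{pmatrix} f \\ f' \end{pmatrix},\begin{pmatrix} h \\ h' \end{pmatrix}\right)\in\Gamma\right\}\subseteq\tilde{\mathcal{K}}\times\tilde{\mathcal{K}},$$ and $\mathcal{J}^{-1}$ is its inverse. $\mathcal{K}^2$ and $\mathcal{H}^2$ are Krein spaces with $[\hat f,\hat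 g]_{\mathcal{K}^2}=-i[f',g]+i[f,g']$ and $[\hat h,\hat k]_{\mathcal{H}^2}=-i(h',k)+i(h,k')$ (inner products linear in the first argument), where $\hat f=(f,f')$, etc. A Green's boundary relation is a linear relation $\Gamma\subseteq\mathcal{K}^2\times\mathcal{H}^2$ with $[\hat f,\hat g]_{\mathcal{K}^2}=[\hat h,\hat k]_{\mathcal{H}^2}$ for all $(\hat f,\hat h),(\hat g,\hat k)\in\Gamma$. It is unitary if $\Gamma^{-1}=\Gamma^*$, where $\Gamma^{-1}=\{(\hat h,\hat f):(\hat f,\hat h)\in\Gamma\}$ and $\Gamma^*=\{(\hat k,\hat g)\in\mathcal{H}^2\times\mathcal{K}^2:[\hat f,\hat g]_{\mathcal{K}^2}=[\hat h,\hat k]_{\mathcal{H}^2}\ \forall(\hat f,\hat h)\in\Gamma\}$. A unitary relation $\Gamma$ is trivial if $\Gamma=\ker\Gamma\times\operatorname{mul}\Gamma$, where $\ker\Gamma=\{\hat f:(\hat f,0)\in\Gamma\}$ and $\operatorname{mul}\Gamma=\{\hat h:(0,\hat h)\in\Gamma\}$. *)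

theory Defs
  imports "HOL-Analysis.Analysis"
begin

text \<open>
  A complex vector space is a type of class \<open>ab_group_add\<close> together with an explicit scalar
  multiplication satisfying the library locale \<open>vector_space\<close>; the type classes for inner product
  spaces are real and positive definite, hence not applicable here.
  Forms are linear in the first argument.
\<close>

locale hermitian_space = vector_space scale
  for scale :: "complex \<Rightarrow> 'a::ab_group_add \<Rightarrow> 'a" +
  fixes ip :: "'a \<Rightarrow> 'a \<Rightarrow> complex"
  assumes ip_add_left: "ip (x + y) z = ip x z + ip y z"
    and ip_scale_left: "ip (scale c x) z = c * ip x z"
    and ip_commute: "ip y x = cnj (ip x y)"

text \<open>
  The absolute value makes \<open>ip_dist\<close> nonnegative on the whole space, as \<open>Metric_space\<close> requires;
  on a positive (or negative) definite subspace it is the usual norm distance.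
\<close>

definition ip_dist :: "('a::ab_group_add \<Rightarrow> 'a \<Rightarrow> complex) \<Rightarrow> 'a \<Rightarrow> 'a \<Rightarrow> real" where
  "ip_dist ip x y = sqrt (cmod (ip (x - y) (x - y)))"

definition hilbert_on ::
  "(complex \<Rightarrow> 'a::ab_group_add \<Rightarrow> 'a) \<Rightarrow> ('a \<Rightarrow> 'a \<Rightarrow> complex) \<Rightarrow> 'a set \<Rightarrow> bool" where
  "hilbert_on s ip S \<longleftrightarrow>
     module.subspace s S \<and>
     (\<forall>x\<in>S. x \<noteq> 0 \<longrightarrow> 0 < Re (ip x x)) \<and>
     Metric_space.mcomplete S (ip_dist ip)"

locale hilbert_space = hermitian_space +
  assumes hilbert: "hilbert_on scale ip UNIV"

locale krein_space = hermitian_space +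
  assumes fundamental_decomposition:
    "\<exists>P N. hilbert_on scale ip P \<and> hilbert_on scale (\<lambda>x y. - ip x y) N \<and>
           (\<forall>p\<in>P. \<forall>n\<in>N. ip p n = 0) \<and>
           P \<inter> N = {0} \<and> (\<forall>x. \<exists>p\<in>P. \<exists>n\<in>N. x = p + n)"

definition prod_scale ::
  "(complex \<Rightarrow> 'a \<Rightarrow> 'a) \<Rightarrow> (complex \<Rightarrow> 'b \<Rightarrow> 'b) \<Rightarrow> complex \<Rightarrow> 'a \<times> 'b \<Rightarrow> 'a \<times> 'b" where
  "prod_scale s t c = map_prod (s c) (t c)"

definition prod_ip ::
  "('a \<Rightarrow> 'a \<Rightarrow> complex) \<Rightarrow> ('b \<Rightarrow> 'b \<Rightarrow> complex) \<Rightarrow> 'a \<times> 'b \<Rightarrow> 'a \<times> 'b \<Rightarrow> complex" where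
  "prod_ip ipa ipb = (\<lambda>(f, h) (g, k). ipa f g + ipb h k)"

definition linear_relation ::
  "(complex \<Rightarrow> 'a::ab_group_add \<Rightarrow> 'a) \<Rightarrow> (complex \<Rightarrow> 'b::ab_group_add \<Rightarrow> 'b) \<Rightarrow>
   ('a \<times> 'b) set \<Rightarrow> bool" where
  "linear_relation s t R \<longleftrightarrow> module.subspace (prod_scale s t) R"

definition rel_adjoint :: "('a \<Rightarrow> 'a \<Rightarrow> complex) \<Rightarrow> ('a \<times> 'a) set \<Rightarrow> ('a \<times> 'a) set" where
  "rel_adjoint ip A = {(k, h). \<forall>(f, g)\<in>A. ip f h = ip g k}"

definition self_adjoint_relation ::
  "(complex \<Rightarrow> 'a::ab_group_add \<Rightarrow> 'a) \<Rightarrow> ('a \<Rightarrow> 'a \<Rightarrow> complex) \<Rightarrow> ('a \<times> 'a) set \<Rightarrow> bool" where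
  "self_adjoint_relation s ip A \<longleftrightarrow> linear_relation s s A \<and> A = rel_adjoint ip A"

definition orthogonal_sum ::
  "('a \<times> 'a) set \<Rightarrow> ('b \<times> 'b) set \<Rightarrow> (('a \<times> 'b) \<times> ('a \<times> 'b)) set" (infixl \<open>[+]\<close> 65) where
  "A1 [+] A2 = {((f1, f2), (f1', f2')) | f1 f2 f1' f2'. (f1, f1') \<in> A1 \<and> (f2, f2') \<in> A2}"

definition boundary_form :: "('a \<Rightarrow> 'a \<Rightarrow> complex) \<Rightarrow> 'a \<times> 'a \<Rightarrow> 'a \<times> 'a \<Rightarrow> complex" where
  "boundary_form ip = (\<lambda>(f, f') (g, g'). - \<i> * ip f' g + \<i> * ip f g')"

definition greens_boundary_relation ::
  "(complex \<Rightarrow> 'a::ab_group_add \<Rightarrow> 'a) \<Rightarrow> ('a \<Rightarrow> 'a \<Rightarrow> complex) \<Rightarrow>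
   (complex \<Rightarrow> 'b::ab_group_add \<Rightarrow> 'b) \<Rightarrow> ('b \<Rightarrow> 'b \<Rightarrow> complex) \<Rightarrow>
   (('a \<times> 'a) \<times> ('b \<times> 'b)) set \<Rightarrow> bool" where
  "greens_boundary_relation sa ipa sb ipb \<Gamma> \<longleftrightarrow>
     linear_relation (prod_scale sa sa) (prod_scale sb sb) \<Gamma> \<and>
     (\<forall>(f, h)\<in>\<Gamma>. \<forall>(g, k)\<in>\<Gamma>. boundary_form ipa f g = boundary_form ipb h k)"

definition boundary_adjoint ::
  "('a \<Rightarrow> 'a \<Rightarrow> complex) \<Rightarrow> ('b \<Rightarrow> 'b \<Rightarrow> complex) \<Rightarrow>
   (('a \<times> 'a) \<times> ('b \<times> 'b)) set \<Rightarrow> (('b \<times> 'b) \<times> ('a \<times> 'a)) set" where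
  "boundary_adjoint ipa ipb \<Gamma> =
     {(k, g). \<forall>(f, h)\<in>\<Gamma>. boundary_form ipa f g = boundary_form ipb h k}"

definition unitary_relation ::
  "('a \<Rightarrow> 'a \<Rightarrow> complex) \<Rightarrow> ('b \<Rightarrow> 'b \<Rightarrow> complex) \<Rightarrow> (('a \<times> 'a) \<times> ('b \<times> 'b)) set \<Rightarrow> bool" where
  "unitary_relation ipa ipb \<Gamma> \<longleftrightarrow> \<Gamma>\<inverse> = boundary_adjoint ipa ipb \<Gamma>"

definition ker_rel :: "('a \<times> 'b::zero) set \<Rightarrow> 'a set" where
  "ker_rel \<Gamma> = {f. (f, 0) \<in> \<Gamma>}"

definition mul_rel :: "('a::zero \<times> 'b) set \<Rightarrow> 'b set" where
  "mul_rel \<Gamma> = {h. (0, h) \<in> \<Gamma>}"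

definition trivial_relation :: "('a::zero \<times> 'b::zero) set \<Rightarrow> bool" where
  "trivial_relation \<Gamma> \<longleftrightarrow> \<Gamma> = ker_rel \<Gamma> \<times> mul_rel \<Gamma>"

definition main_transform ::
  "(('a \<times> 'a) \<times> ('b::ab_group_add \<times> 'b)) set \<Rightarrow> (('a \<times> 'b) \<times> ('a \<times> 'b)) set" where
  "main_transform \<Gamma> = {((f, h), (f', - h')) | f f' h h'. ((f, f'), (h, h')) \<in> \<Gamma>}"

lemma vector_space_prod_scale:
  assumes "vector_space s" and "vector_space t"
  shows "vector_space (prod_scale s t)"
proof -
  interpret s: vector_space s by fact
  interpret t: vector_space t by fact
  show ?thesis
    by unfold_locales (auto simp: prod_scale_def plus_prod_def map_prod_def
        s.scale_right_distrib t.scale_right_distrib s.scale_left_distrib t.scale_left_distrib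
        split: prod.splits)
qed

text \<open>The main transformation is a bijection, so \<open>inv main_transform\<close> is its two-sided inverse.\<close>

lemma bij_main_transform: "bij main_transform"
proof (rule bijI)
  have mem: "((f, h), (f', h')) \<in> main_transform \<Gamma> \<longleftrightarrow> ((f, f'), (h, - h')) \<in> \<Gamma>"
    for f f' :: 'x and h h' :: "'y::ab_group_add" and \<Gamma>
    unfolding main_transform_def by force
  show "inj (main_transform :: (('a \<times> 'a) \<times> ('b::ab_group_add \<times> 'b)) set \<Rightarrow> _)"
  proof (rule injI)
    fix \<Gamma> \<Delta> :: "(('a \<times> 'a) \<times> ('b \<times> 'b)) set"
    assume eq: "main_transform \<Gamma> = main_transform \<Delta>"
    have "((f, f'), (h, h')) \<in> \<Gamma> \<longleftrightarrow> ((f, f'), (h, h')) \<in> \<Delta>" for f f' h h'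
      using mem[of f h f' "- h'" \<Gamma>] mem[of f h f' "- h'" \<Delta>] eq by simp
    then show "\<Gamma> = \<Delta>" by auto
  qed
  show "surj (main_transform :: (('a \<times> 'a) \<times> ('b::ab_group_add \<times> 'b)) set \<Rightarrow> _)"
  proof (rule surjI)
    fix A :: "(('a \<times> 'b) \<times> ('a \<times> 'b)) set"
    show "main_transform {((f, f'), (h, h')) | f f' h h'. ((f, h), (f', - h')) \<in> A} = A"
      by (auto simp: mem)
  qed
qed

text \<open>The orthogonal sum of a Krein space and a Hilbert space is a Krein space.\<close>

lemma (in hermitian_space) ip_right:
  "ip z (x + y) = ip z x + ip z y" "ip z (scale c x) = cnj c * ip z x"
  "ip 0 z = 0" "ip z 0 = 0" "ip (x - y) z = ip x z - ip y z" "ip z (x - y) = ip z x - ip z y"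
  "Im (ip x x) = 0"
proof -
  show r: "ip z (x + y) = ip z x + ip z y" for x y z
    by (metis ip_add_left ip_commute complex_cnj_add)
  show "ip z (scale c x) = cnj c * ip z x"
    by (metis ip_scale_left ip_commute complex_cnj_mult)
  show l0: "ip 0 z = 0" for z using ip_add_left[of 0 0 z] by simp
  show r0: "ip z 0 = 0" for z using r[of z 0 0] by simp
  show "ip (x - y) z = ip x z - ip y z"
    by (metis add_diff_cancel diff_add_cancel ip_add_left)
  show "ip z (x - y) = ip z x - ip z y"
    by (metis add_diff_cancel diff_add_cancel r)
  show "Im (ip x x) = 0"
    using ip_commute[of x x] by (metis cnj.simps(2) neg_equal_zero)
qed

lemma (in hermitian_space) Metric_space_ip_dist:
  assumes sub: "subspace S" and pos: "\<forall>x\<in>S. x \<noteq> 0 \<longrightarrow> 0 < Re (ip x x)"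
  shows "Metric_space S (ip_dist ip)"
proof -
  have nn: "0 \<le> Re (ip x x)" if "x \<in> S" for x
    using pos that by (cases "x = 0") (auto simp: ip_right less_imp_le)
  have re: "ip x x = complex_of_real (Re (ip x x))" for x
    by (simp add: complex_eq_iff ip_right)
  have cs: "(cmod (ip x y))\<^sup>2 \<le> Re (ip x x) * Re (ip y y)" if xy: "x \<in> S" "y \<in> S" for x y
  proof (cases "y = 0")
    case True then show ?thesis by (simp add: ip_right)
  next
    case False
    define a where "a = Re (ip y y)"
    define c where "c = ip x y"
    have a: "a > 0" using pos False xy by (simp add: a_def)
    have yy: "ip y y = of_real a" using re[of y] by (simp add: a_def)
    have yx: "ip y x = cnj c" unfolding c_def by (rule ip_commute)
    let ?v = "scale (of_real a) x - scale c y"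
    have "?v \<in> S" using sub xy by (simp add: subspace_diff subspace_scale)
    then have "0 \<le> Re (ip ?v ?v)" by (rule nn)
    also have "ip ?v ?v = of_real (a * (a * Re (ip x x) - (cmod c)\<^sup>2))"
    proof -
      obtain b where b: "ip x x = of_real b" using re by blast
      have "ip ?v ?v = of_real a * (of_real a * of_real b - c * cnj c)"
        by (simp add: ip_right ip_scale_left yy yx b c_def[symmetric] algebra_simps)
      then show ?thesis by (simp add: b flip: complex_norm_square)
    qed
    finally have "0 \<le> a * (a * Re (ip x x) - (cmod c)\<^sup>2)" by simp
    with a have "(cmod c)\<^sup>2 \<le> a * Re (ip x x)" by (simp add: zero_le_mult_iff)
    then show ?thesis by (simp add: a_def c_def mult.commute)
  qed
  have tri: "sqrt (Re (ip (x + y) (x + y))) \<le> sqrt (Re (ip x x)) + sqrt (Re (ip y y))"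
    if xy: "x \<in> S" "y \<in> S" for x y
  proof (rule real_le_lsqrt)
    show "0 \<le> sqrt (Re (ip x x)) + sqrt (Re (ip y y))" using nn xy by simp
    have "Re (ip x y) \<le> cmod (ip x y)" by (rule complex_Re_le_cmod)
    also have "\<dots> \<le> sqrt (Re (ip x x)) * sqrt (Re (ip y y))"
      using cs[OF xy] by (simp add: real_le_rsqrt flip: real_sqrt_mult)
    finally have "Re (ip x y) \<le> sqrt (Re (ip x x)) * sqrt (Re (ip y y))" .
    moreover have "Re (ip y x) = Re (ip x y)" by (subst ip_commute) simp
    ultimately show "Re (ip (x + y) (x + y)) \<le> (sqrt (Re (ip x x)) + sqrt (Re (ip y y)))\<^sup>2"
      using nn xy by (simp add: ip_right ip_add_left power2_sum)
  qed
  have dist: "ip_dist ip x y = sqrt (Re (ip (x - y) (x - y)))" if "x \<in> S" "y \<in> S" for x y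
    using nn[of "x - y"] re[of "x - y"] sub that
    by (metis ip_dist_def norm_of_real abs_of_nonneg subspace_diff)
  have neg: "ip (x - y) (x - y) = ip (y - x) (y - x)" for x y
    by (simp add: ip_right)
  show ?thesis
  proof
    fix x y show "0 \<le> ip_dist ip x y" by (simp add: ip_dist_def)
  next
    fix x y show "ip_dist ip x y = ip_dist ip y x" by (simp add: ip_dist_def neg[of x y])
  next
    fix x y assume "x \<in> S" "y \<in> S"
    then have "x - y \<in> S" using sub by (simp add: subspace_diff)
    then show "ip_dist ip x y = 0 \<longleftrightarrow> x = y"
      using pos by (force simp: ip_dist_def ip_right)
  next
    fix x y z assume "x \<in> S" "y \<in> S" "z \<in> S"
    then show "ip_dist ip x z \<le> ip_dist ip x y + ip_dist ip y z"
      using tri[of "x - y" "y - z"] sub by (simp add: dist subspace_diff)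
  qed
qed

lemma hermitian_space_prod:
  assumes "hermitian_space s ipa" and "hermitian_space t ipb"
  shows "hermitian_space (prod_scale s t) (prod_ip ipa ipb)"
proof -
  interpret a: hermitian_space s ipa by fact
  interpret b: hermitian_space t ipb by fact
  show ?thesis
  proof (intro hermitian_space.intro vector_space_prod_scale hermitian_space_axioms.intro)
    show "prod_ip ipa ipb y x = cnj (prod_ip ipa ipb x y)" for x y
      using a.ip_commute[of "fst x" "fst y"] b.ip_commute[of "snd x" "snd y"]
      by (simp add: prod_ip_def case_prod_unfold)
  qed (auto simp: prod_ip_def prod_scale_def a.ip_add_left b.ip_add_left a.ip_scale_left
        b.ip_scale_left algebra_simps a.vector_space_axioms b.vector_space_axioms
        split: prod.splits)
qed

lemma hermitian_space_uminus:
  assumes "hermitian_space s ip"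
  shows "hermitian_space s (\<lambda>x y. - ip x y)"
proof -
  interpret hermitian_space s ip by fact
  show ?thesis
  proof
    show "- ip y x = cnj (- ip x y)" for x y
      by (simp flip: ip_commute)
  qed (auto simp: ip_add_left ip_scale_left)
qed

lemma hilbert_on_prod:
  assumes a: "hermitian_space s ipa" and b: "hermitian_space t ipb"
    and S: "hilbert_on s ipa S" and T: "hilbert_on t ipb T"
  shows "hilbert_on (prod_scale s t) (prod_ip ipa ipb) (S \<times> T)"
proof -
  interpret a: hermitian_space s ipa by fact
  interpret b: hermitian_space t ipb by fact
  interpret c: hermitian_space "prod_scale s t" "prod_ip ipa ipb"
    using a b by (rule hermitian_space_prod)
  have sS: "a.subspace S" and pS: "\<forall>x\<in>S. x \<noteq> 0 \<longrightarrow> 0 < Re (ipa x x)"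
    and sT: "b.subspace T" and pT: "\<forall>x\<in>T. x \<noteq> 0 \<longrightarrow> 0 < Re (ipb x x)"
    using S T by (auto simp: hilbert_on_def)
  interpret M: Metric_space12 S "ip_dist ipa" T "ip_dist ipb"
    using a.Metric_space_ip_dist[OF sS pS] b.Metric_space_ip_dist[OF sT pT]
    by (rule Metric_space12.intro)
  have sub: "c.subspace (S \<times> T)"
    using sS sT by (auto simp: c.subspace_def a.subspace_def b.subspace_def prod_scale_def zero_prod_def)
  have nS: "0 \<le> Re (ipa x x)" if "x \<in> S" for x
    using pS that by (cases "x = 0") (auto simp: a.ip_right less_imp_le)
  have nT: "0 \<le> Re (ipb x x)" if "x \<in> T" for x
    using pT that by (cases "x = 0") (auto simp: b.ip_right less_imp_le)
  have pos: "\<forall>x\<in>S \<times> T. x \<noteq> 0 \<longrightarrow> 0 < Re (prod_ip ipa ipb x x)"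
    using nS nT pS pT by (auto simp: prod_ip_def zero_prod_def add_pos_nonneg add_nonneg_pos)
  interpret C: Metric_space "S \<times> T" "ip_dist (prod_ip ipa ipb)"
    using sub pos by (rule c.Metric_space_ip_dist)
  have d: "ip_dist (prod_ip ipa ipb) x y = prod_dist (ip_dist ipa) (ip_dist ipb) x y"
    if xy: "x \<in> S \<times> T" "y \<in> S \<times> T" for x y
  proof -
    obtain x1 x2 y1 y2 where x: "x = (x1, x2)" "y = (y1, y2)" by (metis surj_pair)
    have "x1 - y1 \<in> S" "x2 - y2 \<in> T"
      using xy x sS sT by (auto simp: a.subspace_diff b.subspace_diff)
    then have "0 \<le> Re (ipa (x1 - y1) (x1 - y1))" "0 \<le> Re (ipb (x2 - y2) (x2 - y2))"
      using nS nT by auto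
    moreover have "Im (ipa (x1 - y1) (x1 - y1)) = 0" "Im (ipb (x2 - y2) (x2 - y2)) = 0"
      by (simp_all only: a.ip_right(7) b.ip_right(7))
    ultimately show ?thesis
      by (simp add: x ip_dist_def prod_dist_def prod_ip_def cmod_def)
  qed
  have "C.mcomplete"
    unfolding C.mcomplete_def
  proof (intro allI impI)
    fix \<sigma> assume "C.MCauchy \<sigma>"
    then have "M.Prod_metric.MCauchy \<sigma>"
      unfolding C.MCauchy_def M.Prod_metric.MCauchy_def using d
      by (metis range_subsetD)
    moreover have "M.Prod_metric.mcomplete"
      using S T by (simp add: M.mcomplete_prod_metric hilbert_on_def)
    ultimately obtain x where x: "limitin M.Prod_metric.mtopology \<sigma> x sequentially"
      unfolding M.Prod_metric.mcomplete_def by blast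
    have "limitin C.mtopology \<sigma> x sequentially"
      using x unfolding C.limitin_metric M.Prod_metric.limitin_metric
      by (auto elim!: eventually_mono simp: d)
    then show "\<exists>x. limitin C.mtopology \<sigma> x sequentially" ..
  qed
  with sub pos show ?thesis by (simp add: hilbert_on_def)
qed

lemma hilbert_on_zero:
  assumes "hermitian_space s ip"
  shows "hilbert_on s ip {0}"
proof -
  interpret hermitian_space s ip by fact
  interpret Z: Metric_space "{0}" "ip_dist ip"
    by (rule Metric_space_ip_dist) simp_all
  have "Z.mcomplete"
    unfolding Z.mcomplete_def
  proof (intro allI impI exI)
    fix \<sigma> assume "Z.MCauchy \<sigma>"
    then have "\<sigma> n = 0" for n by (auto simp: Z.MCauchy_def)
    then show "limitin Z.mtopology \<sigma> 0 sequentially" by (simp add: Z.limitin_metric)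
  qed
  then show ?thesis by (simp add: hilbert_on_def)
qed

lemma krein_space_prod:
  assumes K: "krein_space s ipa" and H: "hilbert_space t ipb"
  shows "krein_space (prod_scale s t) (prod_ip ipa ipb)"
proof -
  interpret K: krein_space s ipa by fact
  interpret H: hilbert_space t ipb by fact
  note a = K.hermitian_space_axioms and b = H.hermitian_space_axioms
  have neg: "hermitian_space s (\<lambda>x y. - ipa x y)" "hermitian_space t (\<lambda>x y. - ipb x y)"
    by (rule hermitian_space_uminus; fact a b)+
  obtain P N where P: "hilbert_on s ipa P" and N: "hilbert_on s (\<lambda>x y. - ipa x y) N"
    and orth: "\<forall>p\<in>P. \<forall>n\<in>N. ipa p n = 0" and PN: "P \<inter> N = {0}"
    and dec: "\<forall>x. \<exists>p\<in>P. \<exists>n\<in>N. x = p + n"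
    using K.fundamental_decomposition by blast
  have Z: "hilbert_on t (\<lambda>x y. - ipb x y) {0}"
    using neg(2) by (rule hilbert_on_zero)
  have eq: "prod_ip (\<lambda>x y. - ipa x y) (\<lambda>x y. - ipb x y) = (\<lambda>x y. - prod_ip ipa ipb x y)"
    by (auto simp: prod_ip_def fun_eq_iff)
  have "hilbert_on (prod_scale s t) (prod_ip ipa ipb) (P \<times> UNIV)"
    by (rule hilbert_on_prod[OF a b P H.hilbert])
  moreover have "hilbert_on (prod_scale s t) (\<lambda>x y. - prod_ip ipa ipb x y) (N \<times> {0})"
    using hilbert_on_prod[OF neg N Z] unfolding eq .
  moreover have "\<forall>p\<in>P \<times> UNIV. \<forall>n\<in>N \<times> {0}. prod_ip ipa ipb p n = 0"
    using orth by (auto simp: prod_ip_def H.ip_right)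
  moreover have "(P \<times> UNIV) \<inter> (N \<times> {0}) = {0 :: 'a \<times> 'b}"
    using PN by (auto simp: zero_prod_def)
  moreover have "\<exists>p\<in>P \<times> UNIV. \<exists>n\<in>N \<times> {0}. x = p + n" for x :: "'a \<times> 'b"
  proof -
    obtain p n where "p \<in> P" "n \<in> N" "fst x = p + n" using dec by blast
    then show ?thesis
      by (intro bexI[of _ "(p, snd x)"] bexI[of _ "(n, 0)"]) (auto simp: prod_eq_iff)
  qed
  ultimately show ?thesis
    by (intro krein_space.intro hermitian_space_prod[OF a b] krein_space_axioms.intro) blast
qed

end

theory Submission
  imports Defs
begin

text \<open>
  The main transformation only permutes the four components of \<open>\<Gamma>\<close> and changes the sign of one of
  them. With these signs, the equation for a pair to lie in the Krein space adjoint of \<open>\<J>(\<Gamma>)\<close>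
  and the equation for the corresponding pair to lie in the adjoint of \<open>\<Gamma>\<close> with respect to the two
  boundary forms differ only by rearrangement and the factor \<open>\<i>\<close>. Hence the transformation
  intertwines the two notions of adjoint (\<open>rel_adjoint_main_transform\<close>), and since it is injective and preserves and reflects linearity,
  \<open>\<J>(\<Gamma>)\<close> is self-adjoint if and only if \<open>\<Gamma>\<close> is a unitary Green's boundary relation
  (\<open>self_adjoint_main_transform_iff\<close>).

  On the other hand, the rearrangement sends a Cartesian product \<open>R \<times> S\<close> of relations to the orthogonal
  sum of \<open>R\<close> with \<open>S\<close>, the latter with the sign of its second component reversed
  (\<open>main_transform_Times\<close>). A linear \<open>\<Gamma>\<close> is trivial precisely if it is a Cartesian product of
  linear relations, so trivial relations correspond to orthogonal sums.
\<close>

lemma (in hermitian_space) ip_minus: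
  "ip (- x) y = - ip x y" "ip x (- y) = - ip x y"
  using ip_right(5)[of 0 x y] ip_right(6)[of x 0 y] by (simp_all add: ip_right)

lemma linear_relation_iff:
  assumes "vector_space s" and "vector_space t"
  shows "linear_relation s t R \<longleftrightarrow>
    (0, 0) \<in> R \<and>
    (\<forall>x y x' y'. (x, y) \<in> R \<longrightarrow> (x', y') \<in> R \<longrightarrow> (x + x', y + y') \<in> R) \<and>
    (\<forall>c x y. (x, y) \<in> R \<longrightarrow> (s c x, t c y) \<in> R)"
proof -
  interpret vector_space "prod_scale s t"
    using assms by (rule vector_space_prod_scale)
  show ?thesis
    unfolding linear_relation_def subspace_def
    by (simp add: Ball_def prod_scale_def zero_prod_def)
qed

lemma mem_main_transform:
  "((f, h), (f', h')) \<in> main_transform \<Gamma> \<longleftrightarrow> ((f, f'), (h, - h')) \<in> \<Gamma>"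
  unfolding main_transform_def by force

lemma mem_negate_second:
  fixes h' :: "'b::ab_group_add"
  shows "(h, h') \<in> map_prod id uminus ` R \<longleftrightarrow> (h, - h') \<in> R"
  by force

lemma linear_relation_negate_second:
  assumes s: "vector_space s" and t: "vector_space t" and R: "linear_relation s t R"
  shows "linear_relation s t (map_prod id uminus ` R)"
proof -
  interpret t: vector_space t by fact
  \<comment> \<open>A negated sum must stay a sum of negatives, so that closure under addition applies to it.\<close>
  show ?thesis
    using R unfolding linear_relation_iff[OF s t] mem_negate_second
    by (simp del: add_uminus_conv_diff uminus_add_conv_diff flip: t.scale_minus_right)
qed

lemma linear_relation_main_transform_iff:
  assumes s: "vector_space s" and t: "vector_space t"
  shows "linear_relation (prod_scale s t) (prod_scale s t) (main_transform \<Gamma>) \<longleftrightarrow>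
    linear_relation (prod_scale s s) (prod_scale t t) \<Gamma>" (is "?L \<longleftrightarrow> ?R")
proof -
  interpret t: vector_space t by fact
  note st = vector_space_prod_scale[OF s t]
  note iffL = linear_relation_iff[OF st st]
  note iffR = linear_relation_iff[OF vector_space_prod_scale[OF s s] vector_space_prod_scale[OF t t]]
  have mem': "((f, f'), (h, h')) \<in> \<Gamma> \<longleftrightarrow> ((f, h), (f', - h')) \<in> main_transform \<Gamma>" for f f' h h'
    by (simp add: mem_main_transform)
  show ?thesis
  proof
    assume ?L
    then show ?R
      unfolding iffL iffR
      by (simp add: mem' prod_scale_def zero_prod_def
          del: add_uminus_conv_diff uminus_add_conv_diff flip: t.scale_minus_right)
  next
    assume ?R
    then show ?L
      unfolding iffL iffR
      by (simp add: mem_main_transform prod_scale_def zero_prod_def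
          del: add_uminus_conv_diff uminus_add_conv_diff flip: t.scale_minus_right)
  qed
qed

text \<open>
  For \<open>((f, f'), (h, h')) \<in> \<Gamma>\<close>, the pair \<open>((g, k), (g', - k'))\<close> satisfies the adjointness condition
  for \<open>\<J>(\<Gamma>)\<close> if \<open>[f, g'] - (h, k') = [f', g] - (h', k)\<close>. Collecting the terms of each space on one
  side and multiplying by \<open>\<i>\<close> turns this into equality of the boundary forms.
\<close>

lemma rel_adjoint_main_transform:
  assumes "hermitian_space s ipa" and "hermitian_space t ipb"
  shows "rel_adjoint (prod_ip ipa ipb) (main_transform \<Gamma>) =
    main_transform ((boundary_adjoint ipa ipb \<Gamma>)\<inverse>)"
proof -
  interpret a: hermitian_space s ipa by fact
  interpret b: hermitian_space t ipb by fact
  have forms: "prod_ip ipa ipb (f, h) (g', - k') = prod_ip ipa ipb (f', - h') (g, k) \<longleftrightarrow>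
      boundary_form ipa (f, f') (g, g') = boundary_form ipb (h, h') (k, k')" for f f' g g' h h' k k'
  proof -
    have "boundary_form ipa (f, f') (g, g') - boundary_form ipb (h, h') (k, k') =
        \<i> * (prod_ip ipa ipb (f, h) (g', - k') - prod_ip ipa ipb (f', - h') (g, k))"
      by (simp add: boundary_form_def prod_ip_def b.ip_minus algebra_simps)
    then show ?thesis
      by (metis complex_i_not_zero eq_iff_diff_eq_0 mult_eq_0_iff)
  qed
  have "((g, k), (g', k')) \<in> rel_adjoint (prod_ip ipa ipb) (main_transform \<Gamma>) \<longleftrightarrow>
      ((g, g'), (k, - k')) \<in> (boundary_adjoint ipa ipb \<Gamma>)\<inverse>" for g g' k k'
    using forms[where k' = "- k'"]
    by (fastforce simp: rel_adjoint_def boundary_adjoint_def main_transform_def)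
  then show ?thesis
    by (auto simp: mem_main_transform)
qed

lemma self_adjoint_main_transform_iff:
  assumes a: "hermitian_space s ipa" and b: "hermitian_space t ipb"
  shows "self_adjoint_relation (prod_scale s t) (prod_ip ipa ipb) (main_transform \<Gamma>) \<longleftrightarrow>
    greens_boundary_relation s ipa t ipb \<Gamma> \<and> unitary_relation ipa ipb \<Gamma>"
proof -
  have vs: "vector_space s" "vector_space t"
    using a b by (simp_all add: hermitian_space_def)
  have "main_transform \<Gamma> = rel_adjoint (prod_ip ipa ipb) (main_transform \<Gamma>) \<longleftrightarrow>
      \<Gamma> = (boundary_adjoint ipa ipb \<Gamma>)\<inverse>"
    by (simp add: rel_adjoint_main_transform[OF a b] inj_eq[OF bij_is_inj[OF bij_main_transform]])
  also have "\<dots> \<longleftrightarrow> unitary_relation ipa ipb \<Gamma>"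
    unfolding unitary_relation_def by (metis converse_converse)
  finally have adj: "main_transform \<Gamma> = rel_adjoint (prod_ip ipa ipb) (main_transform \<Gamma>) \<longleftrightarrow>
      unitary_relation ipa ipb \<Gamma>" .
  \<comment> \<open>Green's identity on \<open>\<Gamma>\<close> is the inclusion of \<open>\<Gamma>\<inverse>\<close> in the adjoint, one half of unitarity.\<close>
  have green: "boundary_form ipa f g = boundary_form ipb h k"
    if "unitary_relation ipa ipb \<Gamma>" "(f, h) \<in> \<Gamma>" "(g, k) \<in> \<Gamma>" for f g h k
  proof -
    have "(k, g) \<in> boundary_adjoint ipa ipb \<Gamma>"
      using that unfolding unitary_relation_def by blast
    with \<open>(f, h) \<in> \<Gamma>\<close> show ?thesis
      by (auto simp: boundary_adjoint_def)
  qed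
  show ?thesis
    using adj green
    by (auto simp: self_adjoint_relation_def greens_boundary_relation_def
        linear_relation_main_transform_iff[OF vs])
qed

lemma main_transform_Times:
  "main_transform (R \<times> S) = R [+] (map_prod id uminus ` S)"
  by (auto simp: mem_main_transform orthogonal_sum_def mem_negate_second)

lemma inv_main_transform_orthogonal_sum:
  "inv main_transform (A [+] B) = A \<times> (map_prod id uminus ` B)"
proof (rule inv_f_eq[OF bij_is_inj[OF bij_main_transform]])
  show "main_transform (A \<times> (map_prod id uminus ` B)) = A [+] B"
    by (simp add: main_transform_Times image_image map_prod_def case_prod_unfold)
qed

lemma trivial_relation_Times:
  assumes "0 \<in> R" and "0 \<in> S"
  shows "trivial_relation (R \<times> S)"
  using assms by (auto simp: trivial_relation_def ker_rel_def mul_rel_def)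

lemma linear_relation_ker_mul:
  assumes s: "vector_space s" and t: "vector_space t"
    and \<Gamma>: "linear_relation (prod_scale s s) (prod_scale t t) \<Gamma>"
  shows "linear_relation s s (ker_rel \<Gamma>)" and "linear_relation t t (mul_rel \<Gamma>)"
proof -
  interpret s: vector_space s by fact
  interpret t: vector_space t by fact
  have zero: "(0, 0) \<in> \<Gamma>"
    and add: "\<And>x y x' y'. (x, y) \<in> \<Gamma> \<Longrightarrow> (x', y') \<in> \<Gamma> \<Longrightarrow> (x + x', y + y') \<in> \<Gamma>"
    and scale: "\<And>c x y. (x, y) \<in> \<Gamma> \<Longrightarrow> (prod_scale s s c x, prod_scale t t c y) \<in> \<Gamma>"
    using \<Gamma>
    unfolding linear_relation_iff[OF vector_space_prod_scale[OF s s] vector_space_prod_scale[OF t t]]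
    by blast+
  have s0: "prod_scale s s c 0 = 0" and t0: "prod_scale t t c 0 = 0" for c
    by (simp_all add: prod_scale_def zero_prod_def)
  show "linear_relation s s (ker_rel \<Gamma>)"
    unfolding linear_relation_iff[OF s s] ker_rel_def
    using zero add[of _ 0 _ 0] scale[of _ 0] t0 by (auto simp: zero_prod_def prod_scale_def)
  show "linear_relation t t (mul_rel \<Gamma>)"
    unfolding linear_relation_iff[OF t t] mul_rel_def
    using zero add[of 0 _ 0 _] scale[of 0 _] s0 by (auto simp: zero_prod_def prod_scale_def)
qed

theorem proposition5p6:
  fixes scaleK :: "complex \<Rightarrow> 'k::ab_group_add \<Rightarrow> 'k" and ipK :: "'k \<Rightarrow> 'k \<Rightarrow> complex"
    and scaleH :: "complex \<Rightarrow> 'h::ab_group_add \<Rightarrow> 'h" and ipH :: "'h \<Rightarrow> 'h \<Rightarrow> complex"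
  assumes "krein_space scaleK ipK" and "hilbert_space scaleH ipH"
  shows
    "(\<forall>A. self_adjoint_relation (prod_scale scaleK scaleH) (prod_ip ipK ipH) A \<and>
          (\<exists>A1 A2. linear_relation scaleK scaleK A1 \<and> linear_relation scaleH scaleH A2 \<and>
                   A = A1 [+] A2) \<longrightarrow>
          greens_boundary_relation scaleK ipK scaleH ipH (inv main_transform A) \<and>
          unitary_relation ipK ipH (inv main_transform A) \<and>
          trivial_relation (inv main_transform A)) \<and>
     (\<forall>\<Gamma>. greens_boundary_relation scaleK ipK scaleH ipH \<Gamma> \<and>
          unitary_relation ipK ipH \<Gamma> \<and>
          trivial_relation \<Gamma> \<longrightarrow>
          self_adjoint_relation (prod_scale scaleK scaleH) (prod_ip ipK ipH) (main_transform \<Gamma>) \<and>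
          (\<exists>A1 A2. linear_relation scaleK scaleK A1 \<and> linear_relation scaleH scaleH A2 \<and>
                   main_transform \<Gamma> = A1 [+] A2))"
proof -
  interpret K: krein_space scaleK ipK by fact
  interpret H: hilbert_space scaleH ipH by fact
  note vK = K.vector_space_axioms and vH = H.vector_space_axioms
  note self_adjoint_iff =
    self_adjoint_main_transform_iff[OF K.hermitian_space_axioms H.hermitian_space_axioms]
  show ?thesis
  proof (intro conjI allI impI; elim conjE exE)
    fix A A1 A2
    assume A: "self_adjoint_relation (prod_scale scaleK scaleH) (prod_ip ipK ipH) A"
      and A1: "linear_relation scaleK scaleK A1" and A2: "linear_relation scaleH scaleH A2"
      and sum: "A = A1 [+] A2"
    have "main_transform (inv main_transform A) = A"
      by (rule surj_f_inv_f[OF bij_is_surj[OF bij_main_transform]])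
    with A have gu: "greens_boundary_relation scaleK ipK scaleH ipH (inv main_transform A) \<and>
        unitary_relation ipK ipH (inv main_transform A)"
      by (simp flip: self_adjoint_iff)
    then show "greens_boundary_relation scaleK ipK scaleH ipH (inv main_transform A)"
      and "unitary_relation ipK ipH (inv main_transform A)"
      by simp_all
    have "0 \<in> A1" and "0 \<in> map_prod id uminus ` A2"
      using A1 linear_relation_negate_second[OF vH vH A2]
      unfolding linear_relation_iff[OF vK vK] linear_relation_iff[OF vH vH]
      by (simp_all add: zero_prod_def)
    then show "trivial_relation (inv main_transform A)"
      unfolding sum inv_main_transform_orthogonal_sum by (rule trivial_relation_Times)
  next
    fix \<Gamma>
    assume green: "greens_boundary_relation scaleK ipK scaleH ipH \<Gamma>"
      and unitary: "unitary_relation ipK ipH \<Gamma>" and trivial: "trivial_relation \<Gamma>"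
    show "self_adjoint_relation (prod_scale scaleK scaleH) (prod_ip ipK ipH) (main_transform \<Gamma>)"
      using green unitary by (simp add: self_adjoint_iff)
    have "linear_relation (prod_scale scaleK scaleK) (prod_scale scaleH scaleH) \<Gamma>"
      using green by (simp add: greens_boundary_relation_def)
    note lin = linear_relation_ker_mul[OF vK vH this]
    have "main_transform \<Gamma> = ker_rel \<Gamma> [+] (map_prod id uminus ` mul_rel \<Gamma>)"
      using trivial main_transform_Times unfolding trivial_relation_def by metis
    then show "\<exists>A1 A2. linear_relation scaleK scaleK A1 \<and> linear_relation scaleH scaleH A2 \<and>
        main_transform \<Gamma> = A1 [+] A2"
      using lin(1) linear_relation_negate_second[OF vH vH lin(2)] by blast
  qed
qed

end
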